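(* For $k=0,1,2,\ldots$ let $l_k=\tfrac{1}{2^k}$, $t_k=\tfrac12(l_{k+1}+l_k)$ and $s_k=1+2^{-2k}$, and let $p_k$ be the unique polynomial of degree at most nine satisfying the ten conditions: $p_k$ and $-t^2$ agree up to and including their respective third derivatives at $t=l_{k+1}$ and at $t=l_k$; $p_k(t_k)=-t_k^2$; and $p_k'(t_k)=s_k\cdot(-2t_k)$. Define $f_1:[-1,1]\to\mathbb{R}$ by $$f_1(t)=\begin{cases} p_k(t) & \text{if } t\in[l_{k+1},l_k] \text{ for } k=0,1,2,\ldots,\\ -t^2 & \text{if } t\in[-1,0].\end{cases}$$ Then $f_1$ is $\mathcal{C}^3$ on its domain $[-1,1]$.
   Context: $\mathcal{C}^3$ means three times continuously differentiable (with one-sided derivatives at the endpoints $\pm1$ of the domain). *)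

theory Defs
  imports "HOL-Analysis.Analysis" "HOL-Computational_Algebra.Polynomial"
begin

(* Derivatives are taken within S; for S = {a..b} they are one-sided at a and b. *)
primrec C_k_on :: "nat \<Rightarrow> (real \<Rightarrow> real) \<Rightarrow> real set \<Rightarrow> bool" where
  "C_k_on 0 f S \<longleftrightarrow> continuous_on S f"
| "C_k_on (Suc k) f S \<longleftrightarrow>
     (\<exists>f'. (\<forall>x\<in>S. (f has_real_derivative f' x) (at x within S)) \<and> C_k_on k f' S)"

definition l_seq :: "nat \<Rightarrow> real" where
  "l_seq k = 1 / 2 ^ k"

definition t_seq :: "nat \<Rightarrow> real" where
  "t_seq k = (l_seq (Suc k) + l_seq k) / 2"

definition s_seq :: "nat \<Rightarrow> real" where
  "s_seq k = 1 + 1 / 2 ^ (2 * k)"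

definition neg_sq :: "real poly" where
  "neg_sq = monom (-1) 2"

lemma poly_neg_sq: "poly neg_sq t = - t\<^sup>2"
  by (simp add: neg_sq_def poly_monom)

definition is_interp :: "nat \<Rightarrow> real poly \<Rightarrow> bool" where
  "is_interp k p \<longleftrightarrow> degree p \<le> 9
     \<and> (\<forall>j\<le>3. poly ((pderiv ^^ j) p) (l_seq (Suc k)) = poly ((pderiv ^^ j) neg_sq) (l_seq (Suc k)))
     \<and> (\<forall>j\<le>3. poly ((pderiv ^^ j) p) (l_seq k) = poly ((pderiv ^^ j) neg_sq) (l_seq k))
     \<and> poly p (t_seq k) = - (t_seq k)\<^sup>2
     \<and> poly (pderiv p) (t_seq k) = s_seq k * (- 2 * t_seq k)"

definition interp :: "nat \<Rightarrow> real poly" where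
  "interp k = (THE p. is_interp k p)"

(* Consecutive intervals share an endpoint, so a piece has to be chosen there; the lemma f1_piece
   below shows that the choice does not matter. Values outside {-1..1} are irrelevant. *)
definition f1 :: "real \<Rightarrow> real" where
  "f1 t = (if t \<le> 0 then - t\<^sup>2
           else poly (interp (LEAST k. t \<in> {l_seq (Suc k)..l_seq k})) t)"

lemma pow_dvd_pderiv_iff:
  fixes d :: "real poly"
  shows "[:-a, 1:] ^ Suc n dvd d \<longleftrightarrow> poly d a = 0 \<and> [:-a, 1:] ^ n dvd pderiv d"
proof (cases "d = 0 \<or> poly d a \<noteq> 0")
  case True
  then show ?thesis
    by (metis dvd_0_right dvd_trans dvd_triv_left pderiv_0 poly_0 poly_eq_0_iff_dvd power_Suc)
next
  case False
  then have d: "d \<noteq> 0" "poly d a = 0" by auto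
  have d': "pderiv d \<noteq> 0"
  proof
    assume "pderiv d = 0"
    then obtain c where "d = [:c:]" by (metis pderiv_eq_0_iff degree_eq_zeroE)
    with d show False by simp
  qed
  have "order a d = Suc (order a (pderiv d))" using order_pderiv[OF d] .
  then show ?thesis using d d' by (simp only: order_divides) auto
qed

lemma pow_dvd_iff_pderivs:
  fixes d :: "real poly"
  shows "[:-a, 1:] ^ n dvd d \<longleftrightarrow> (\<forall>j<n. poly ((pderiv ^^ j) d) a = 0)"
proof (induction n arbitrary: d)
  case (Suc n)
  show ?case
    unfolding pow_dvd_pderiv_iff Suc.IH All_less_Suc2 by (simp add: funpow_swap1)
qed simp

lemma higher_pderiv_diff:
  fixes p q :: "real poly"
  shows "(pderiv ^^ j) (p - q) = (pderiv ^^ j) p - (pderiv ^^ j) q"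
  by (induction j) (auto simp: pderiv_diff)

lemma agree_iff_dvd:
  "(\<forall>j\<le>3. poly ((pderiv ^^ j) p) a = poly ((pderiv ^^ j) q) (a::real)) \<longleftrightarrow> [:-a, 1:] ^ 4 dvd p - q"
proof -
  have "(\<forall>j\<le>3. P j) \<longleftrightarrow> (\<forall>j<4. P j)" for P :: "nat \<Rightarrow> bool"
    by (metis less_Suc_eq_le numeral_eq_Suc pred_numeral_simps(2) semiring_norm(26,27))
  then show ?thesis unfolding pow_dvd_iff_pderivs higher_pderiv_diff by simp
qed

lemma seq_order: "l_seq (Suc k) < t_seq k" "t_seq k < l_seq k" "0 < l_seq k"
  by (simp_all add: l_seq_def t_seq_def field_simps)

lemma ex1_interp: "\<exists>!p. is_interp k p"
proof -
  define a b t where "a = l_seq (Suc k)" and "b = l_seq k" and "t = t_seq k"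
  define s where "s = s_seq k"
  define w where "w = [:-a, 1:] ^ 4 * [:-b, 1:] ^ 4"
  have ord: "a < t" "t < b" using seq_order[of k] by (auto simp: a_def b_def t_def)
  have w0: "w \<noteq> 0" and wt: "poly w t \<noteq> 0"
    using ord by (auto simp: w_def)
  have degw: "degree w = 8"
    by (simp add: w_def degree_mult_eq degree_power_eq)
  have dvd_w: "[:-a, 1:] ^ 4 dvd d \<and> [:-b, 1:] ^ 4 dvd d \<longleftrightarrow> w dvd d" for d :: "real poly"
  proof
    assume *: "[:-a, 1:] ^ 4 dvd d \<and> [:-b, 1:] ^ 4 dvd d"
    then obtain e where e: "d = [:-b, 1:] ^ 4 * e" by (auto elim: dvdE)
    show "w dvd d"
    proof (cases "d = 0")
      case False
      have "order a ([:-b, 1:] ^ 4) = 0" using ord by (intro order_0I) simp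
      then have "order a d = order a e" using False e by (simp add: order_mult)
      then have "[:-a, 1:] ^ 4 dvd e" using * False e by (simp add: order_divides)
      then show ?thesis unfolding w_def e by (metis dvd_refl mult.commute mult_dvd_mono)
    qed simp
  qed (auto simp only: w_def dest: dvd_mult_left dvd_mult_right)
  have degn: "degree neg_sq = 2" by (simp add: neg_sq_def degree_monom_eq)
  have pdn: "poly (pderiv neg_sq) t = - 2 * t"
    by (simp add: neg_sq_def pderiv_monom poly_monom)
  have char: "is_interp k p \<longleftrightarrow> degree p \<le> 9 \<and> w dvd p - neg_sq
      \<and> poly (p - neg_sq) t = 0 \<and> poly (pderiv (p - neg_sq)) t = (s - 1) * (- 2 * t)" for p
    unfolding is_interp_def agree_iff_dvd dvd_w[symmetric] a_def[symmetric] b_def[symmetric]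
      t_def[symmetric] s_def[symmetric]
    by (auto simp: pderiv_diff pdn poly_neg_sq algebra_simps)
  define C where "C = (s - 1) * (- 2 * t) / poly w t"
  define q where "q = neg_sq + w * [:- C * t, C:]"
  show ?thesis
  proof (rule ex1I)
    have "degree (w * [:- C * t, C:]) \<le> 9"
      using degree_mult_le[of w "[:- C * t, C:]"] degw by (auto split: if_splits)
    then have "degree q \<le> 9" unfolding q_def using degn by (intro degree_add_le) auto
    moreover have "poly (pderiv (w * [:- C * t, C:])) t = (s - 1) * (- 2 * t)"
      using wt unfolding pderiv_mult by (simp add: pderiv_pCons C_def del: mult_pCons_right)
    ultimately show "is_interp k q" unfolding char by (simp add: q_def del: mult_pCons_right)
  next
    fix p assume p: "is_interp k p"
    then obtain r where r: "p - neg_sq = w * r" unfolding char by (auto elim: dvdE)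
    have dr: "degree r \<le> 1"
    proof (cases "r = 0")
      case False
      have "degree (p - neg_sq) \<le> 9"
        using p degn unfolding char by (intro degree_diff_le) auto
      then show ?thesis using False w0 degw by (simp add: r degree_mult_eq)
    qed simp
    have r0: "poly r t = 0" using p wt unfolding char r by simp
    have "poly (pderiv r) t = C"
      using p wt r0 unfolding char r by (simp add: pderiv_mult C_def field_simps)
    moreover obtain u v where uv: "r = [:u, v:]"
    proof -
      obtain u r' where u: "r = pCons u r'" by (cases r)
      with dr have "degree r' = 0" by (auto split: if_splits)
      then obtain v where "r' = [:v:]" by (rule degree_eq_zeroE)
      with u that show ?thesis by blast
    qed
    ultimately have "v = C" "u = - C * t" using r0 by (auto simp: pderiv_pCons algebra_simps)
    then show "p = q" using r uv unfolding q_def by (metis add.commute diff_add_cancel)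
  qed
qed

lemma is_interp_interp: "is_interp k (interp k)"
  unfolding interp_def by (rule theI') (rule ex1_interp)

lemma l_seq_less_iff: "l_seq i < l_seq j \<longleftrightarrow> j < i"
  by (simp add: l_seq_def divide_simps)

lemma f1_piece:
  assumes t: "t \<in> {l_seq (Suc k)..l_seq k}"
  shows "f1 t = poly (interp k) t"
proof -
  define m where "m = (LEAST k. t \<in> {l_seq (Suc k)..l_seq k})"
  have m: "t \<in> {l_seq (Suc m)..l_seq m}" and mk: "m \<le> k"
    unfolding m_def using t by (rule LeastI, intro Least_le)
  have "t > 0" using t seq_order(3)[of "Suc k"] by auto
  then have f: "f1 t = poly (interp m) t" by (simp add: f1_def m_def)
  have "\<not> l_seq k < l_seq (Suc m)" using t m by auto
  then have "m = k \<or> k = Suc m" using mk unfolding l_seq_less_iff by linarith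
  then consider "m = k" | "k = Suc m" by blast
  then show ?thesis
  proof cases
    case 2
    then have t': "t = l_seq (Suc m)" using t m by auto
    have "poly (interp m) t = poly neg_sq t"
      using is_interp_interp[of m] t' unfolding is_interp_def by (metis funpow_0 zero_le)
    moreover have "poly (interp k) t = poly neg_sq t"
      using is_interp_interp[of k] t' 2 unfolding is_interp_def by (metis funpow_0 zero_le)
    ultimately show ?thesis using f by simp
  qed (use f in simp)
qed

lemma f1_nonpos: "t \<le> 0 \<Longrightarrow> f1 t = - t\<^sup>2"
  by (simp add: f1_def)

end

theory Submission
  imports Defs
begin

text \<open>
  On the \<open>k\<close>-th interval the interpolation conditions are, up to scaling, independent of \<open>k\<close>: in the
  variable \<open>u = 2 ^ k * t\<close> one has \<open>p\<^sub>k(t) + t\<^sup>2 = 2 ^ (-4 k) * Q(u)\<close> for a fixed polynomial \<open>Q\<close> with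
  fourfold zeros at \<open>1/2\<close> and \<open>1\<close>. Hence \<open>f1(t) + t\<^sup>2 = (\<Sum>k. 2 ^ (-4 k) * \<phi>(2 ^ k * t))\<close>, where \<open>\<phi>\<close>
  is \<open>Q\<close> cut off outside \<open>[1/2, 1]\<close>. Each of three termwise differentiations costs a factor \<open>2 ^ k\<close>,
  so that even the third derivative is a uniformly convergent series.
\<close>

section \<open>Polynomials extended by zero outside an interval\<close>

definition cutoff :: "real \<Rightarrow> real \<Rightarrow> real poly \<Rightarrow> real \<Rightarrow> real" where
  "cutoff a b p x = (if x \<in> {a..b} then poly p x else 0)"

text \<open>As \<open>p\<close> vanishes at both endpoints, clamping the argument to
  \<open>[a, b]\<close> gives zero outside. The clamped form is visibly continuous.\<close>

lemma cutoff_eq_clamp: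
  assumes "a \<le> b" "poly p a = 0" "poly p b = 0"
  shows "cutoff a b p x = poly p (max a (min b x))"
  using assms by (auto simp: cutoff_def max_def min_def)

lemma continuous_on_cutoff:
  assumes "a \<le> b" "poly p a = 0" "poly p b = 0"
  shows "continuous_on S (cutoff a b p)"
  unfolding cutoff_eq_clamp[OF assms, abs_def] by (intro continuous_intros)

lemma cutoff_bounded: "\<exists>M. \<forall>x. \<bar>cutoff a b p x\<bar> \<le> M"
proof -
  have "bounded (poly p ` {a..b})"
    by (intro compact_imp_bounded compact_continuous_image continuous_intros) auto
  then obtain M where M: "\<forall>x\<in>{a..b}. \<bar>poly p x\<bar> \<le> M"
    unfolding bounded_iff by auto
  have "\<bar>cutoff a b p x\<bar> \<le> max M 0" for x
    using M by (auto simp: cutoff_def le_max_iff_disj)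
  then show ?thesis by blast
qed

lemma has_derivative_cutoff:
  assumes "a \<le> b" "poly p a = 0" "poly p b = 0" "poly (pderiv p) a = 0" "poly (pderiv p) b = 0"
  shows "(cutoff a b p has_real_derivative cutoff a b (pderiv p) x) (at x)"
proof -
  have "((\<lambda>x. if x \<in> {a..b} then poly p x else 0) has_vector_derivative
      (if x \<in> {a..b} then poly (pderiv p) x else 0)) (at x within UNIV)"
  proof (rule has_vector_derivative_If_within_closures[where T = "- {a..b}"])
    \<comment> \<open>The two pieces \<open>p\<close> and 0 meet only at \<open>a\<close> and
      \<open>b\<close>, where value and derivative of \<open>p\<close> are zero.\<close>
    have "closure (- {a..b}) \<inter> {a..b} \<subseteq> {a, b}"
      by (auto simp: closure_complement interior_atLeastAtMost_real)
    then have *: "x \<in> {a, b}" if "x \<in> closure {a..b}" "x \<in> closure (- {a..b})"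
      using that by auto
    show "poly p x = 0" if "x \<in> closure {a..b}" "x \<in> closure (- {a..b})"
      using *[OF that] assms by auto
    show "poly (pderiv p) x = 0" if "x \<in> closure {a..b}" "x \<in> closure (- {a..b})"
      using *[OF that] assms by auto
    show "(poly p has_vector_derivative poly (pderiv p) x)
        (at x within {a..b} \<union> closure {a..b} \<inter> closure (- {a..b}))"
      using poly_DERIV[of p x] unfolding has_real_derivative_iff_has_vector_derivative
      by (rule has_vector_derivative_at_within)
  qed auto
  then show ?thesis
    by (simp add: cutoff_def[abs_def] has_real_derivative_iff_has_vector_derivative)
qed

section \<open>Series of dyadically rescaled cutoffs\<close>

text \<open>The parameter \<open>m\<close> counts the remaining factors \<open>(1/2) ^ k\<close>;
  each differentiation consumes one of them.\<close>

definition dyadic_term :: "nat \<Rightarrow> real poly \<Rightarrow> nat \<Rightarrow> real \<Rightarrow> real" where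
  "dyadic_term m p k t = (1/2) ^ (m * k) * cutoff (1/2) 1 p (2 ^ k * t)"

definition dyadic_series :: "nat \<Rightarrow> real poly \<Rightarrow> real \<Rightarrow> real" where
  "dyadic_series m p t = (\<Sum>k. dyadic_term m p k t)"

text \<open>The cutoff has one bound for all arguments, so a single remaining factor
  \<open>(1/2) ^ k\<close> yields a geometric majorant for the Weierstrass test.\<close>

lemma dyadic_term_bounded:
  assumes "m > 0"
  obtains M where "\<And>k t. \<bar>dyadic_term m p k t\<bar> \<le> M * (1/2) ^ k"
proof -
  obtain M where M: "\<And>x. \<bar>cutoff (1/2) 1 p x\<bar> \<le> M"
    using cutoff_bounded by blast
  have "\<bar>dyadic_term m p k t\<bar> \<le> M * (1/2) ^ k" for k t
  proof -
    have "((1/2) ^ (m * k) :: real) \<le> (1/2) ^ k"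
      using assms by (intro power_decreasing) auto
    then have "(1/2) ^ (m * k) * \<bar>cutoff (1/2) 1 p (2 ^ k * t)\<bar> \<le> (1/2) ^ k * M"
      using M by (intro mult_mono) auto
    then show ?thesis by (simp add: dyadic_term_def abs_mult mult.commute)
  qed
  then show thesis by (rule that)
qed

lemma dyadic_uniform_limit:
  assumes "m > 0"
  shows "uniform_limit UNIV (\<lambda>n t. \<Sum>k<n. dyadic_term m p k t) (dyadic_series m p) sequentially"
proof -
  obtain M where M: "\<And>k t. \<bar>dyadic_term m p k t\<bar> \<le> M * (1/2) ^ k"
    using dyadic_term_bounded[OF assms] by blast
  show ?thesis
    unfolding dyadic_series_def[abs_def]
    by (rule Weierstrass_m_test[where M = "\<lambda>k. M * (1/2) ^ k"])
      (use M in \<open>auto intro: summable_mult summable_geometric\<close>)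
qed

lemma continuous_on_dyadic_series:
  assumes "m > 0" "poly p (1/2) = 0" "poly p 1 = 0"
  shows "continuous_on S (dyadic_series m p)"
proof -
  have *: "continuous_on UNIV (\<lambda>t. dyadic_term m p k t)" for k
    unfolding dyadic_term_def
    by (intro continuous_intros continuous_on_compose2[OF continuous_on_cutoff[of _ _ _ UNIV]])
      (use assms in auto)
  have "continuous_on UNIV (dyadic_series m p)"
    by (rule uniform_limit_theorem[OF _ dyadic_uniform_limit])
      (auto intro!: always_eventually continuous_on_sum * assms)
  then show ?thesis by (rule continuous_on_subset) simp
qed

lemma has_derivative_dyadic_series:
  assumes m: "m > 0"
    and p: "poly p (1/2) = 0" "poly p 1 = 0" "poly (pderiv p) (1/2) = 0" "poly (pderiv p) 1 = 0"
  shows "(dyadic_series (Suc m) p has_real_derivative dyadic_series m (pderiv p) t) (at t)"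
proof -
  have termwise: "(dyadic_term (Suc m) p k has_real_derivative dyadic_term m (pderiv p) k t)
      (at t within UNIV)" for k t
  proof -
    have "((\<lambda>t. (1/2) ^ (Suc m * k) * cutoff (1/2) 1 p (2 ^ k * t)) has_real_derivative
        (1/2) ^ (Suc m * k) * (cutoff (1/2) 1 (pderiv p) (2 ^ k * t) * 2 ^ k)) (at t)"
      by (intro DERIV_cmult DERIV_chain2[OF has_derivative_cutoff])
        (use p in \<open>auto intro!: derivative_eq_intros\<close>)
    \<comment> \<open>The inner derivative \<open>2 ^ k\<close> cancels one factor
      \<open>(1/2) ^ k\<close>, lowering \<open>Suc m\<close> to \<open>m\<close>.\<close>
    moreover have scale: "((1/2) ^ (m * k) :: real) = (1/2) ^ (Suc m * k) * 2 ^ k"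
      by (simp add: power_add power_divide)
    ultimately show ?thesis
      unfolding dyadic_term_def[abs_def] scale by (simp only: mult_ac)
  qed
  have conv: "uniformly_convergent_on UNIV (\<lambda>n t. \<Sum>k<n. dyadic_term m (pderiv p) k t)"
    using dyadic_uniform_limit[OF m] unfolding uniformly_convergent_on_def by blast
  \<comment> \<open>Given uniform convergence of the derived series, convergence at one point
    suffices; at 0 all terms vanish.\<close>
  have "summable (\<lambda>k. dyadic_term (Suc m) p k 0)"
    by (simp add: dyadic_term_def cutoff_def)
  from has_field_derivative_series'(2)[OF _ termwise conv UNIV_I this, of t]
  show ?thesis
    by (simp add: dyadic_series_def[abs_def])
qed

section \<open>The interpolants as rescaled copies of one polynomial\<close>

lemma higher_pderiv_rescale:
  fixes p :: "real poly"
  shows "(pderiv ^^ j) (smult c (pcompose p [:0, r:])) =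
    smult (c * r ^ j) (pcompose ((pderiv ^^ j) p) [:0, r:])"
  by (induction j) (auto simp: pderiv_smult pderiv_pcompose pderiv_pCons mult_ac)

lemma higher_pderiv_add:
  fixes p q :: "real poly"
  shows "(pderiv ^^ j) (p + q) = (pderiv ^^ j) p + (pderiv ^^ j) q"
  by (induction j) (auto simp: pderiv_add)

text \<open>The constant normalises the derivative at \<open>3/4\<close> to \<open>-3/2\<close>.\<close>

definition profile :: "real poly" where
  "profile = smult (-98304) ([:-1/2, 1:] ^ 4 * [:-1, 1:] ^ 4 * [:-3/4, 1:])"

lemma degree_profile: "degree profile = 9"
  by (simp add: profile_def degree_mult_eq degree_power_eq del: mult_pCons_right)

lemma poly_profile_mid: "poly profile (3/4) = 0" "poly (pderiv profile) (3/4) = -3/2"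
  by (simp_all add: profile_def pderiv_minus pderiv_smult pderiv_mult pderiv_pCons power_divide
      del: mult_pCons_right)

lemma higher_pderiv_profile:
  assumes "a \<in> {1/2, 1}" "j \<le> 3"
  shows "poly ((pderiv ^^ j) profile) a = 0"
proof -
  have "[:-a, 1:] ^ 4 dvd profile"
  proof (cases "a = 1")
    case True
    show ?thesis unfolding True profile_def
      by (intro dvd_smult dvd_mult2 dvd_mult dvd_refl)
  next
    case False
    then have "[:-a, 1:] = [:-1/2, 1:]" using assms(1) by simp
    then show ?thesis unfolding profile_def
      by (simp only:) (intro dvd_smult dvd_mult2 dvd_refl)
  qed
  then show ?thesis using assms(2) unfolding pow_dvd_iff_pderivs by auto
qed

text \<open>By uniqueness of the interpolant it suffices to check the ten conditions, which
  \<open>2 ^ k\<close> moves to the fixed points \<open>1/2\<close>, \<open>3/4\<close> and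
  \<open>1\<close>.\<close>

lemma interp_eq: "interp k = neg_sq + smult ((1/2) ^ (4 * k)) (pcompose profile [:0, 2 ^ k:])"
proof -
  define q where "q = smult ((1/2) ^ (4 * k)) (pcompose profile [:0, 2 ^ k:])"
  have q: "poly ((pderiv ^^ j) q) x =
      (1/2) ^ (4 * k) * (2 ^ k) ^ j * poly ((pderiv ^^ j) profile) (2 ^ k * x)" for j x
    unfolding q_def higher_pderiv_rescale by (simp add: poly_pcompose mult_ac)
  have pts: "2 ^ k * l_seq (Suc k) = 1/2" "2 ^ k * l_seq k = 1" "2 ^ k * t_seq k = 3/4"
    by (simp_all add: l_seq_def t_seq_def field_simps)
  have tk: "t_seq k = 3/4 * (1/2) ^ k"
    by (simp add: l_seq_def t_seq_def field_simps)
  have "is_interp k (neg_sq + q)"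
    unfolding is_interp_def
  proof (intro conjI allI impI)
    have "degree q \<le> 9"
      by (simp add: q_def degree_pcompose degree_profile)
    then show "degree (neg_sq + q) \<le> 9"
      by (intro degree_add_le) (simp_all add: neg_sq_def degree_monom_eq)
    show "poly (neg_sq + q) (t_seq k) = - (t_seq k)\<^sup>2"
      using q[of 0 "t_seq k"] by (simp add: poly_neg_sq pts poly_profile_mid)
    \<comment> \<open>The required correction of the slope is
      \<open>(s_seq k - 1) * (-2 * t_seq k)\<close>, that is \<open>-3/2 * (1/2) ^ (3 * k)\<close>.
      This dictates the scale \<open>(1/2) ^ (4 * k)\<close>, since differentiating \<open>q\<close>
      gives back \<open>2 ^ k\<close>.\<close>
    have "poly (pderiv q) (t_seq k) = (1/2) ^ (4 * k) * 2 ^ k * (-3/2)"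
      using q[of 1 "t_seq k"] by (simp add: pts poly_profile_mid)
    also have "\<dots> = (1/2) ^ (2 * k) * (-2 * t_seq k)"
      unfolding tk by (simp add: field_simps flip: power_add)
    finally show "poly (pderiv (neg_sq + q)) (t_seq k) = s_seq k * (-2 * t_seq k)"
      by (simp add: pderiv_add neg_sq_def pderiv_monom poly_monom s_seq_def algebra_simps power_divide)
  qed (simp_all add: higher_pderiv_add q pts higher_pderiv_profile)
  then show ?thesis
    unfolding q_def using ex1_interp is_interp_interp by blast
qed

section \<open>Series representation and smoothness of \<open>f1\<close>\<close>

lemma dyadic_interval_exists:
  assumes "0 < t" "t \<le> 1"
  obtains k where "t \<in> {l_seq (Suc k)..l_seq k}"
proof -
  obtain n where "(1/2) ^ n < t" using real_arch_pow_inv[of t "1/2"] assms by auto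
  then have n: "l_seq n < t" by (simp add: l_seq_def power_divide)
  \<comment> \<open>The first \<open>l_seq m\<close> below \<open>t\<close> has positive index
    because \<open>t \<le> 1 = l_seq 0\<close>; its predecessor bounds \<open>t\<close> from
    above.\<close>
  define m where "m = (LEAST n. l_seq n < t)"
  have m: "l_seq m < t" unfolding m_def using n by (rule LeastI)
  have "m \<noteq> 0"
  proof
    assume "m = 0"
    with m assms show False by (simp add: l_seq_def)
  qed
  then obtain k where k: "m = Suc k" by (cases m) auto
  then have "\<not> l_seq k < t"
    unfolding m_def using not_less_Least[of k "\<lambda>n. l_seq n < t"] by simp
  then show thesis using that[of k] m k by auto
qed

text \<open>At most one term is nonzero at any \<open>t\<close>: none for \<open>t \<le> 0\<close>,
  otherwise only that of an interval containing \<open>t\<close>.\<close>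

lemma f1_eq_series:
  assumes "t \<le> 1"
  shows "f1 t = - t\<^sup>2 + dyadic_series 4 profile t"
proof (cases "t \<le> 0")
  case True
  have "dyadic_term 4 profile k t = 0" for k
  proof -
    have "2 ^ k * t \<le> 0" using True by (simp add: mult_le_0_iff)
    then have "2 ^ k * t \<notin> {1/2..1}" by simp
    then show ?thesis by (simp only: dyadic_term_def cutoff_def if_False mult_zero_right)
  qed
  then show ?thesis using True by (simp add: f1_nonpos dyadic_series_def)
next
  case False
  then obtain k where k: "t \<in> {l_seq (Suc k)..l_seq k}"
    using assms dyadic_interval_exists[of t] by auto
  have other: "dyadic_term 4 profile j t = 0" if "j \<noteq> k" for j
  proof (cases "t \<in> {l_seq (Suc j)..l_seq j}")
    case True
    \<comment> \<open>Distinct intervals that meet are neighbours, and their common endpoint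
      rescales to \<open>1/2\<close> or \<open>1\<close>, a zero of \<open>profile\<close>.\<close>
    have "\<not> l_seq k < l_seq (Suc j)" "\<not> l_seq j < l_seq (Suc k)" using k True by auto
    then have "k = Suc j \<or> j = Suc k" using that unfolding l_seq_less_iff by linarith
    then have "t = l_seq j \<or> t = l_seq (Suc j)" using k True by auto
    then have "2 ^ j * t \<in> {1/2, 1}" by (auto simp: l_seq_def)
    then show ?thesis
      using higher_pderiv_profile[of "2 ^ j * t" 0] by (simp add: dyadic_term_def cutoff_def)
  next
    case False
    then have "2 ^ j * t \<notin> {1/2..1}" by (auto simp: l_seq_def field_simps)
    then show ?thesis by (simp only: dyadic_term_def cutoff_def if_False mult_zero_right)
  qed
  have "2 ^ k * t \<in> {1/2..1}" using k by (auto simp: l_seq_def field_simps)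
  then have "dyadic_term 4 profile k t = f1 t + t\<^sup>2"
    unfolding f1_piece[OF k] interp_eq
    by (simp add: dyadic_term_def cutoff_def poly_neg_sq poly_pcompose mult_ac)
  moreover have "dyadic_series 4 profile t = dyadic_term 4 profile k t"
    unfolding dyadic_series_def using suminf_finite[of "{k}" "\<lambda>k. dyadic_term 4 profile k t"] other
    by simp
  ultimately show ?thesis by simp
qed

theorem theorem3p1:
  shows "C_k_on 3 f1 {-1..1}"
proof -
  define Q where "Q j = (pderiv ^^ j) profile" for j
  have Q: "poly (Q j) (1/2) = 0" "poly (Q j) 1 = 0" if "j \<le> 3" for j
    using that by (simp_all add: Q_def higher_pderiv_profile)
  have Q_Suc: "pderiv (Q j) = Q (Suc j)" for j by (simp add: Q_def)
  have D: "(dyadic_series (4 - j) (Q j) has_real_derivative dyadic_series (3 - j) (Q (Suc j)) t)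
      (at t within {-1..1})" if "j \<le> 2" for j t
  proof -
    have "4 - j = Suc (3 - j)" using that by simp
    then show ?thesis
      using has_derivative_dyadic_series[of "3 - j" "Q j" t] Q[of j] Q[of "Suc j"] that
      unfolding Q_Suc by (auto intro: has_field_derivative_at_within)
  qed
  have D0: "(f1 has_real_derivative - 2 * t + dyadic_series 3 (Q 1) t) (at t within {-1..1})"
    if "t \<in> {-1..1}" for t
  \<comment> \<open>The series formula holds throughout \<open>{-1..1}\<close>, so the radius 1 is
    an arbitrary choice.\<close>
  proof (rule has_field_derivative_transform_within[where d = 1])
    show "((\<lambda>t. - t\<^sup>2 + dyadic_series 4 (Q 0) t) has_real_derivative
        - 2 * t + dyadic_series 3 (Q 1) t) (at t within {-1..1})"
      using D[of 0 t] by (auto intro!: derivative_eq_intros)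
  qed (use that in \<open>simp_all add: f1_eq_series Q_def\<close>)
  have D1: "((\<lambda>t. - 2 * t + dyadic_series 3 (Q 1) t) has_real_derivative
      - 2 + dyadic_series 2 (Q 2) t) (at t within {-1..1})" for t
    using D[of 1 t] by (auto intro!: derivative_eq_intros simp: numeral_2_eq_2)
  have D2: "((\<lambda>t. - 2 + dyadic_series 2 (Q 2) t) has_real_derivative
      dyadic_series 1 (Q 3) t) (at t within {-1..1})" for t
    using D[of 2 t] by (auto intro!: derivative_eq_intros simp: numeral_3_eq_3)
  \<comment> \<open>After three differentiations one factor \<open>(1/2) ^ k\<close> is left, and
    \<open>Q 3\<close> still vanishes at \<open>1/2\<close> and \<open>1\<close> because the zeros
    of \<open>profile\<close> are fourfold.\<close>
  have C: "continuous_on {-1..1} (dyadic_series 1 (Q 3))"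
    by (rule continuous_on_dyadic_series) (simp_all add: Q)
  have "C_k_on (Suc (Suc (Suc 0))) f1 {-1..1}"
    unfolding C_k_on.simps by (intro exI conjI ballI) (rule D0 D1 D2 C | assumption)+
  then show ?thesis by (simp only: numeral_3_eq_3)
qed

end
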